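(* Let $j\ge 2$ be an integer. For every integer $K\ge 1$, $$M_{j,K+1}\subseteq M_{j,K}\qquad\text{and}\qquad \operatorname{Area}(M_{j,K+1})\le \operatorname{Area}(M_{j,K}).$$ Moreover $$M_j=\bigcap_{K=1}^{\infty}M_{j,K}\qquad\text{and}\qquad \lim_{K\to\infty}\operatorname{Area}(M_{j,K})=\operatorname{Area}(M_j).$$
   Context: For an integer $j\ge2$ and $c\in\mathbb C$ define $z_0(c)=0$ and $z_{n+1}(c)=z_n(c)^j+c$ for $n\ge 0$. The Multibrot set of degree $j$ is $M_j=\{c\in\mathbb C: (z_n(c))_{n\ge 0}\text{ is bounded}\}$. For an integer $K\ge1$ the finite-iteration set is $M_{j,K}=\{c\in\mathbb C: |z_n(c)|\le 2\text{ for every }1\le n\le K\}$. $\operatorname{Area}$ denotes two-dimensional Lebesgue measure on $\mathbb C\cong\mathbb R^2$. *)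

theory Defs
  imports "HOL-Analysis.Analysis"
begin

primrec crit_orbit :: "nat \<Rightarrow> complex \<Rightarrow> nat \<Rightarrow> complex" where
  "crit_orbit j c 0 = 0"
| "crit_orbit j c (Suc n) = crit_orbit j c n ^ j + c"

definition multibrot :: "nat \<Rightarrow> complex set" where
  "multibrot j = {c. bounded (range (crit_orbit j c))}"

definition multibrot_iter :: "nat \<Rightarrow> nat \<Rightarrow> complex set" where
  "multibrot_iter j K = {c. \<forall>n. 1 \<le> n \<and> n \<le> K \<longrightarrow> norm (crit_orbit j c n) \<le> 2}"

text \<open>The library assigns measure 0 to non-measurable sets; the facts below rule this out,
  so that the Lebesgue measure of these sets really is their area.\<close>

lemma continuous_on_crit_orbit [continuous_intros]:
  "continuous_on A (\<lambda>c. crit_orbit j c n)"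
  by (induction n) (auto intro!: continuous_intros)

lemma multibrot_iter_measurable: "multibrot_iter j K \<in> sets lebesgue"
proof -
  have "multibrot_iter j K = (\<Inter>n\<in>{1..K}. {c. norm (crit_orbit j c n) \<le> 2})"
    by (auto simp: multibrot_iter_def)
  moreover have "closed (\<Inter>n\<in>{1..K}. {c. norm (crit_orbit j c n) \<le> 2})"
    by (intro closed_INT ballI closed_Collect_le continuous_intros)
  ultimately show ?thesis by (simp add: borel_closed)
qed

lemma multibrot_measurable: "multibrot j \<in> sets lebesgue"
proof -
  have "bounded (range f) \<longleftrightarrow> (\<exists>B::nat. \<forall>n. norm (f n) \<le> real B)" for f :: "nat \<Rightarrow> complex"
    unfolding bounded_iff by (metis order_trans rangeE rangeI real_arch_simple)
  then have "multibrot j = (\<Union>B::nat. \<Inter>n. {c. norm (crit_orbit j c n) \<le> real B})"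
    unfolding multibrot_def by blast
  moreover have "closed (\<Inter>n. {c. norm (crit_orbit j c n) \<le> real B})" for B
    by (intro closed_INT ballI closed_Collect_le continuous_intros)
  ultimately have "multibrot j \<in> sets borel" by (auto intro: borel_closed)
  then show ?thesis by simp
qed

end

theory Submission
  imports Defs
begin

text \<open>
  Everything rests on the escape criterion with radius 2. If a point \<open>w\<close> of the critical orbit of
  \<open>c\<close> satisfies \<open>norm w > 2\<close> and \<open>norm w \<ge> norm c\<close>, then \<open>norm (w ^ j)\<close> is at least
  \<open>(norm w)\<^sup>2\<close>, while adding \<open>c\<close> costs at most \<open>norm w\<close>. So the modulus is multiplied by
  at least \<open>norm w - 1 > 1\<close>, both conditions persist, and the orbit grows geometrically
  (\<open>crit_orbit_growth\<close>). An orbit that leaves the closed disc of radius 2 always has such a point: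
  if \<open>norm c > 2\<close> take \<open>z\<^sub>1 = c\<close> itself, and otherwise any point of modulus above 2 exceeds
  \<open>norm c\<close>. Hence an orbit is bounded exactly when it stays in that disc, which is the claimed
  intersection formula.

  The sets for finitely many iterations decrease by definition, and for one iteration the set is the
  closed disc of radius 2, which has finite area. Continuity of measure from above therefore
  gives convergence of the areas.
\<close>

text \<open>The expansion factor is expressed through a fixed lower bound \<open>r\<close> for the modulus, so that
  the same factor applies at every later step of the orbit.\<close>

lemma escape_step:
  fixes w c :: complex
  assumes "j \<ge> 2" "r > 2" "norm c \<le> r" "r \<le> norm w"
  shows "(r - 1) * norm w \<le> norm (w ^ j + c)"
proof -
  have "(r - 1) * norm w \<le> (norm w - 1) * norm w"
    using assms by (intro mult_right_mono) auto
  also have "\<dots> = norm w ^ 2 - norm w"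
    by (simp add: power2_eq_square algebra_simps)
  also have "\<dots> \<le> norm w ^ j - norm c"
    using assms power_increasing[of 2 j "norm w"] by linarith
  also have "\<dots> \<le> norm (w ^ j + c)"
    using norm_diff_ineq[of "w ^ j" c] by (simp add: norm_power)
  finally show ?thesis .
qed

lemma crit_orbit_growth:
  assumes "j \<ge> 2" "norm (crit_orbit j c m) > 2" "norm c \<le> norm (crit_orbit j c m)"
  shows "(norm (crit_orbit j c m) - 1) ^ k * norm (crit_orbit j c m)
           \<le> norm (crit_orbit j c (m + k))"
proof (induction k)
  case 0
  show ?case by simp
next
  case (Suc k)
  define r where "r = norm (crit_orbit j c m)"
  have r: "r > 2" "norm c \<le> r" using assms by (auto simp: r_def)
  have IH: "(r - 1) ^ k * r \<le> norm (crit_orbit j c (m + k))"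
    using Suc.IH by (simp add: r_def)
  have "1 * r \<le> (r - 1) ^ k * r"
    using r by (intro mult_right_mono one_le_power) auto
  with IH have "r \<le> norm (crit_orbit j c (m + k))" by simp
  from escape_step[OF assms(1) r this]
  have "(r - 1) * norm (crit_orbit j c (m + k)) \<le> norm (crit_orbit j c (m + Suc k))"
    by simp
  moreover have "(r - 1) * ((r - 1) ^ k * r) \<le> (r - 1) * norm (crit_orbit j c (m + k))"
    using IH r by (intro mult_left_mono) auto
  ultimately show ?case by (simp add: r_def mult.assoc)
qed

lemma crit_orbit_unbounded:
  assumes "j \<ge> 2" "norm (crit_orbit j c m) > 2" "norm c \<le> norm (crit_orbit j c m)"
  shows "\<not> bounded (range (crit_orbit j c))"
proof
  define r where "r = norm (crit_orbit j c m)"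
  have r: "r > 2" using assms by (simp add: r_def)
  assume "bounded (range (crit_orbit j c))"
  then obtain B where B: "\<And>n. norm (crit_orbit j c n) \<le> B"
    by (auto simp: bounded_iff)
  obtain k where k: "B < (r - 1) ^ k"
    using real_arch_pow[of "r - 1" B] r by auto
  have "(r - 1) ^ k * 1 \<le> (r - 1) ^ k * r"
    using r by (intro mult_left_mono) auto
  also have "\<dots> \<le> B"
    using crit_orbit_growth[OF assms, of k] B[of "m + k"] by (simp add: r_def)
  finally show False using k by simp
qed

text \<open>The exponent must be positive here because \<open>0 ^ 0 = 1\<close> would make the first iterate
  \<open>1 + c\<close> instead of \<open>c\<close>.\<close>

lemma crit_orbit_1: "j > 0 \<Longrightarrow> crit_orbit j c 1 = c"
  by simp

lemma bounded_crit_orbit_iff: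
  assumes "j \<ge> 2"
  shows "bounded (range (crit_orbit j c)) \<longleftrightarrow> (\<forall>n. norm (crit_orbit j c n) \<le> 2)"
proof
  assume bdd: "bounded (range (crit_orbit j c))"
  have "norm c \<le> 2"
  proof (rule ccontr)
    assume "\<not> norm c \<le> 2"
    moreover have "crit_orbit j c 1 = c" using assms by (intro crit_orbit_1) simp
    ultimately show False using crit_orbit_unbounded[OF assms, of c 1] bdd by (simp del: One_nat_def crit_orbit.simps(2))
  qed
  then show "\<forall>n. norm (crit_orbit j c n) \<le> 2"
    using crit_orbit_unbounded[OF assms, of c] bdd by (meson le_less_trans not_le less_imp_le)
next
  assume "\<forall>n. norm (crit_orbit j c n) \<le> 2"
  then show "bounded (range (crit_orbit j c))"
    by (auto simp: bounded_iff)
qed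

lemma multibrot_eq_INT:
  assumes "j \<ge> 2"
  shows "multibrot j = (\<Inter>K\<in>{1..}. multibrot_iter j K)"
proof -
  have "(\<forall>n. norm (crit_orbit j c n) \<le> 2) \<longleftrightarrow> (\<forall>K\<in>{1..}. c \<in> multibrot_iter j K)" for c
  proof
    assume R: "\<forall>K\<in>{1..}. c \<in> multibrot_iter j K"
    show "\<forall>n. norm (crit_orbit j c n) \<le> 2"
    proof
      fix n
      show "norm (crit_orbit j c n) \<le> 2"
        using R by (cases n) (auto simp: multibrot_iter_def simp del: crit_orbit.simps(2))
    qed
  qed (auto simp: multibrot_iter_def)
  then show ?thesis
    using bounded_crit_orbit_iff[OF assms] by (auto simp: multibrot_def)
qed

lemma multibrot_iter_antimono: "K \<le> L \<Longrightarrow> multibrot_iter j L \<subseteq> multibrot_iter j K"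
  by (auto simp: multibrot_iter_def)

lemma multibrot_iter_1: "j > 0 \<Longrightarrow> multibrot_iter j 1 = cball 0 2"
  using crit_orbit_1[of j]
  by (auto simp: multibrot_iter_def dest: le_antisym simp del: crit_orbit.simps(2))

lemma emeasure_multibrot_iter_finite:
  assumes "j > 0" "K \<ge> 1"
  shows "emeasure lebesgue (multibrot_iter j K) < \<infinity>"
proof -
  have "emeasure lebesgue (multibrot_iter j K) \<le> emeasure lebesgue (cball (0::complex) 2)"
    using multibrot_iter_antimono[OF assms(2), of j] multibrot_iter_1[OF assms(1)]
    by (intro emeasure_mono) auto
  also have "\<dots> < \<infinity>"
    using emeasure_bounded_finite[of "cball (0::complex) 2"] by simp
  finally show ?thesis .
qed

lemma tendsto_emeasure_multibrot_iter:
  assumes "j \<ge> 2"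
  shows "(\<lambda>K. emeasure lebesgue (multibrot_iter j K)) \<longlonglongrightarrow> emeasure lebesgue (multibrot j)"
proof -
  \<comment> \<open>For \<open>K = 0\<close> the set is the whole plane, of infinite measure, so continuity from above
    is applied to the sequence that starts at \<open>K = 1\<close>.\<close>
  have "(\<lambda>K. emeasure lebesgue (multibrot_iter j (Suc K)))
          \<longlonglongrightarrow> emeasure lebesgue (\<Inter>K. multibrot_iter j (Suc K))"
  proof (rule Lim_emeasure_decseq)
    show "range (\<lambda>K. multibrot_iter j (Suc K)) \<subseteq> sets lebesgue"
      using multibrot_iter_measurable by auto
    show "decseq (\<lambda>K. multibrot_iter j (Suc K))"
      by (intro antimonoI multibrot_iter_antimono) simp
    show "emeasure lebesgue (multibrot_iter j (Suc K)) \<noteq> \<infinity>" for K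
      using emeasure_multibrot_iter_finite[of j "Suc K"] assms by auto
  qed
  moreover have "(\<Inter>K. multibrot_iter j (Suc K)) = (\<Inter>K\<in>range Suc. multibrot_iter j K)"
    by simp
  moreover have "range Suc = {1..}"
    by (auto simp: image_iff Suc_le_eq gr0_conv_Suc)
  ultimately have "(\<lambda>K. emeasure lebesgue (multibrot_iter j (Suc K)))
                     \<longlonglongrightarrow> emeasure lebesgue (multibrot j)"
    using multibrot_eq_INT[OF assms] by simp
  then show ?thesis
    by (rule LIMSEQ_imp_Suc)
qed

theorem mainTheorem1:
  fixes j :: nat
  assumes "j \<ge> 2"
  shows "(\<forall>K\<ge>1. multibrot_iter j (K + 1) \<subseteq> multibrot_iter j K
            \<and> emeasure lebesgue (multibrot_iter j (K + 1)) \<le> emeasure lebesgue (multibrot_iter j K))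
       \<and> multibrot j = (\<Inter>K\<in>{1..}. multibrot_iter j K)
       \<and> (\<lambda>K. emeasure lebesgue (multibrot_iter j K)) \<longlonglongrightarrow> emeasure lebesgue (multibrot j)"
proof (intro conjI allI impI)
  fix K :: nat
  show sub: "multibrot_iter j (K + 1) \<subseteq> multibrot_iter j K"
    by (rule multibrot_iter_antimono) simp
  show "emeasure lebesgue (multibrot_iter j (K + 1)) \<le> emeasure lebesgue (multibrot_iter j K)"
    using sub multibrot_iter_measurable by (rule emeasure_mono)
qed (fact multibrot_eq_INT[OF assms] tendsto_emeasure_multibrot_iter[OF assms])+

end
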